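(* Let $X$ be a half-synchronized system. Then $(X,\sigma)$ is mixing if and only if $X$ has a relatively prime generator, i.e. a generator $\mathcal{W}$ of $X$ with $\gcd\{|w|: w\in\mathcal{W}\}=1$.
   Context: Let $A$ be a finite alphabet and give $A^{\mathbb{Z}}$ the product topology of the discrete topology on $A$. The shift map is $\sigma((a_i)_{i\in\mathbb{Z}})=(a_{i+1})_{i\in\mathbb{Z}}$. A subshift is a nonempty closed $\sigma$-invariant subset $X\subseteq A^{\mathbb{Z}}$, with $\sigma$ restricted to it. Its language $\mathcal{L}(X)$ is the set of finite words occurring as consecutive entries in some point of $X$. The length of a word $w$ is $|w|$. Generator: a countable set $\mathcal{W}$ of (nonempty) finite words over $A$ is a generator of the subshift $X$ if $X$ is the closure of the set of all bi-infinite sequences obtained by concatenating elements of $\mathcal{W}$ in arbitrary order (with arbitrary position of the origin). Equivalently, $\mathcal{L}(X)$ is the set of all subwords of finite concatenations of elements of $\mathcal{W}$. For nonempty open sets $U,V\subseteq X$ put $N(U,V)=\{n\in\mathbb{Z}: U\cap\sigma^{-n}V\neq\emptyset\}$. $X$ is transitive if $N(U,V)\ne\emptyset$ for all nonempty open $U,V$, and mixing if $N(U,V)$ is cofinite for all nonempty open $U,V$. Rays: for $x\in X$, the left ray of $x$ is $x_-=x_{(-\infty,0]}$ and the right ray is $x_+=x_{(0,\infty)}$; $X^-$ and $X^+$ denote the sets of left and right rays of points of $X$. A left ray $x_-$ is (left) transitive if every word of $\mathcal{L}(X)$ occurs in $x_-$. For $\eta$ a word in $\mathcal{L}(X)$ or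 a left ray, the follower set is $\omega_+(\eta)=\{y_+\in X^+: \eta y_+ \text{ is admissible}\}$, where admissible means that $\eta y_+$ occurs in a point of $X$. Half-synchronized: a transitive subshift $X$ is half-synchronized if there are a word $m\in\mathcal{L}(X)$ (called a half-synchronizing word) and a left transitive ray $x_-\in X^-$ such that $x_{-|m|+1}\cdots x_0=m$ and $\omega_+(x_-)=\omega_+(m)$. *)

theory Defs
  imports "HOL-Analysis.Function_Topology"
begin

definition full_shift :: "'a set \<Rightarrow> (int \<Rightarrow> 'a) topology" where
  "full_shift A = product_topology (\<lambda>_. discrete_topology A) UNIV"

definition shift_map :: "(int \<Rightarrow> 'a) \<Rightarrow> (int \<Rightarrow> 'a)" where
  "shift_map x = (\<lambda>i. x (i + 1))"

definition shift_power :: "int \<Rightarrow> (int \<Rightarrow> 'a) \<Rightarrow> (int \<Rightarrow> 'a)" where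
  "shift_power n = (if n \<ge> 0 then shift_map ^^ nat n else inv shift_map ^^ nat (- n))"

lemma shift_power_apply: "shift_power n x = (\<lambda>i. x (i + n))"
proof -
  have pos: "(shift_map ^^ k) x = (\<lambda>i. x (i + int k))" for k and x :: "int \<Rightarrow> 'a"
    by (induction k arbitrary: x) (simp_all add: shift_map_def algebra_simps)
  have "inv shift_map = (\<lambda>(x :: int \<Rightarrow> 'a) i. x (i - 1))"
    by (rule inv_unique_comp) (auto simp: shift_map_def fun_eq_iff)
  then have neg: "(inv shift_map ^^ k) x = (\<lambda>i. x (i - int k))" for k and x :: "int \<Rightarrow> 'a"
    by (induction k arbitrary: x) (simp_all add: algebra_simps)
  show ?thesis
    by (simp add: shift_power_def pos neg)
qed

text \<open>Invariance of a two-sided subshift is meant in the sense that the shift maps it onto itself.\<close>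

definition subshift :: "'a set \<Rightarrow> (int \<Rightarrow> 'a) set \<Rightarrow> bool" where
  "subshift A X \<longleftrightarrow> X \<noteq> {} \<and> closedin (full_shift A) X \<and> shift_map ` X = X"

definition occurs_at :: "'a list \<Rightarrow> (int \<Rightarrow> 'a) \<Rightarrow> int \<Rightarrow> bool" where
  "occurs_at w x i \<longleftrightarrow> (\<forall>k < length w. x (i + int k) = w ! k)"

definition language :: "(int \<Rightarrow> 'a) set \<Rightarrow> 'a list set" where
  "language X = {w. \<exists>x\<in>X. \<exists>i. occurs_at w x i}"

text \<open>The word \<open>ws j\<close> starts at coordinate \<open>p j\<close>.  If no word of \<open>W\<close> is empty, \<open>p\<close> is
  strictly increasing, so that the words cover all coordinates.\<close>

definition biinfinite_concats :: "'a list set \<Rightarrow> (int \<Rightarrow> 'a) set" where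
  "biinfinite_concats W =
     {x. \<exists>ws p. (\<forall>j::int. ws j \<in> W \<and> p (j + 1) = p j + int (length (ws j)) \<and>
                          occurs_at (ws j) x (p j))}"

definition generator :: "'a set \<Rightarrow> (int \<Rightarrow> 'a) set \<Rightarrow> 'a list set \<Rightarrow> bool" where
  "generator A X W \<longleftrightarrow>
     countable W \<and> W \<subseteq> lists A - {[]} \<and> X = (full_shift A) closure_of (biinfinite_concats W)"

definition hitting_times :: "(int \<Rightarrow> 'a) set \<Rightarrow> (int \<Rightarrow> 'a) set \<Rightarrow> int set" where
  "hitting_times U V = {n. U \<inter> shift_power (- n) ` V \<noteq> {}}"

definition transitive_shift :: "'a set \<Rightarrow> (int \<Rightarrow> 'a) set \<Rightarrow> bool" where
  "transitive_shift A X \<longleftrightarrow>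
     (\<forall>U V. openin (subtopology (full_shift A) X) U \<and> openin (subtopology (full_shift A) X) V \<and>
            U \<noteq> {} \<and> V \<noteq> {} \<longrightarrow> hitting_times U V \<noteq> {})"

definition mixing_shift :: "'a set \<Rightarrow> (int \<Rightarrow> 'a) set \<Rightarrow> bool" where
  "mixing_shift A X \<longleftrightarrow>
     (\<forall>U V. openin (subtopology (full_shift A) X) U \<and> openin (subtopology (full_shift A) X) V \<and>
            U \<noteq> {} \<and> V \<noteq> {} \<longrightarrow> finite (- hitting_times U V))"

text \<open>Rays keep their coordinates in the bi-infinite sequence and are \<^term>\<open>undefined\<close> elsewhere.\<close>

definition left_ray :: "(int \<Rightarrow> 'a) \<Rightarrow> (int \<Rightarrow> 'a)" where
  "left_ray x = restrict x {..0}"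

definition right_ray :: "(int \<Rightarrow> 'a) \<Rightarrow> (int \<Rightarrow> 'a)" where
  "right_ray x = restrict x {0<..}"

definition left_transitive :: "(int \<Rightarrow> 'a) set \<Rightarrow> (int \<Rightarrow> 'a) \<Rightarrow> bool" where
  "left_transitive X r \<longleftrightarrow> (\<forall>w\<in>language X. \<exists>i. i + int (length w) \<le> 1 \<and> occurs_at w r i)"

text \<open>In both follower sets, \<open>n\<close> is the coordinate of the last letter before the right ray.\<close>

definition word_followers :: "(int \<Rightarrow> 'a) set \<Rightarrow> 'a list \<Rightarrow> (int \<Rightarrow> 'a) set" where
  "word_followers X w =
     {y \<in> right_ray ` X. \<exists>z\<in>X. \<exists>n. occurs_at w z (n - int (length w) + 1) \<and>
                                   (\<forall>i>0. z (n + i) = y i)}"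

definition ray_followers :: "(int \<Rightarrow> 'a) set \<Rightarrow> (int \<Rightarrow> 'a) \<Rightarrow> (int \<Rightarrow> 'a) set" where
  "ray_followers X r =
     {y \<in> right_ray ` X. \<exists>z\<in>X. \<exists>n. (\<forall>i\<le>0. z (n + i) = r i) \<and> (\<forall>i>0. z (n + i) = y i)}"

definition half_synchronized :: "'a set \<Rightarrow> (int \<Rightarrow> 'a) set \<Rightarrow> bool" where
  "half_synchronized A X \<longleftrightarrow>
     subshift A X \<and> transitive_shift A X \<and>
     (\<exists>m\<in>language X. \<exists>r\<in>left_ray ` X.
        left_transitive X r \<and> occurs_at m r (- int (length m) + 1) \<and>
        ray_followers X r = word_followers X m)"

end

theory Submission imports Defs begin

text \<open>If \<open>W\<close> is a relatively prime generator, concatenations of words of \<open>W\<close> attain every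
  sufficiently large length, so any two words of the language can be joined with every sufficiently
  large gap.  Conversely, let \<open>m\<close> be half-synchronizing with left transitive ray \<open>r\<close>, and let \<open>W\<close>
  consist of the nonempty words \<open>c\<close> such that \<open>m c\<close> is a suffix of \<open>r\<close>.  If \<open>r y\<close> is admissible then
  so is \<open>m c y\<close>, being a part of it, hence so is \<open>r c y\<close>; thus all concatenations of words of \<open>W\<close> are
  admissible.  Mixing and left transitivity of \<open>r\<close> make \<open>W\<close> a generator, and they yield
  occurrences of \<open>m\<close> in \<open>r\<close> at distance \<open>n\<close> for every large \<open>n\<close>, which forces the lengths to be
  relatively prime.\<close>

section \<open>Numerical semigroups\<close>

text \<open>The least positive difference \<open>d\<close> of two elements of \<open>S\<close>
  divides every element of \<open>S\<close>, so it is 1. Hence \<open>S\<close> contains some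
  \<open>a\<close> and \<open>a + 1\<close>, and these two generate every
  \<open>n >= a * a\<close>.\<close>

lemma submonoid_nat_cofinite:
  fixes S :: "nat set"
  assumes zero: "0 \<in> S" and add: "\<And>a b. a \<in> S \<Longrightarrow> b \<in> S \<Longrightarrow> a + b \<in> S"
    and gcd: "Gcd S = 1"
  shows "\<exists>N. \<forall>n\<ge>N. n \<in> S"
proof -
  have mult: "k * a \<in> S" if "a \<in> S" for k a
    using that by (induction k) (auto intro: zero add)
  define P where "P d \<longleftrightarrow> 0 < d \<and> (\<exists>a\<in>S. a + d \<in> S)" for d
  have "\<exists>s\<in>S. 0 < s"
  proof (rule ccontr)
    assume "\<not> ?thesis"
    then have "S \<subseteq> {0}" by auto
    then have "Gcd S = 0" by (simp add: Gcd_0_iff)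
    with gcd show False by simp
  qed
  then obtain s where "P s" unfolding P_def using zero by (metis add_0)
  define d where "d = (LEAST d. P d)"
  have "P d" unfolding d_def using \<open>P s\<close> by (rule LeastI)
  then obtain a where a: "a \<in> S" "a + d \<in> S" and "0 < d" by (auto simp: P_def)
  have "d dvd t" if "t \<in> S" for t
  proof (rule ccontr)
    assume "\<not> d dvd t"
    then have pos: "0 < t mod d" by (simp add: dvd_eq_mod_eq_0)
    \<comment> \<open>Both \<open>t + (t div d) * a\<close> and \<open>(t div d) * (a + d)\<close>
      lie in \<open>S\<close>, so \<open>t mod d\<close> is again a difference, smaller than the
      least one.\<close>
    have "t + (t div d) * a = (t div d) * (a + d) + t mod d"
      by (simp add: algebra_simps)
    then have "P (t mod d)"
      unfolding P_def using pos mult[OF a(2), of "t div d"] add[OF that mult[OF a(1), of "t div d"]]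
      by (metis)
    then have "d \<le> t mod d" unfolding d_def by (rule Least_le)
    moreover have "t mod d < d" using \<open>0 < d\<close> by simp
    ultimately show False by simp
  qed
  then have "d dvd Gcd S" by (rule Gcd_greatest)
  with gcd have "d = 1" by simp
  have "n \<in> S" if "n \<ge> a * a" for n
  proof (cases "a = 0")
    case True
    then have "1 \<in> S" using a(2) \<open>d = 1\<close> by simp
    from mult[OF this, of n] show ?thesis by simp
  next
    case False
    \<comment> \<open>Dividing by \<open>a\<close>, the quotient exceeds the remainder, so
      \<open>n mod a\<close> of the summands \<open>a\<close> can each be raised to
      \<open>a + 1\<close>.\<close>
    then have "a \<le> n div a" using that by (simp add: less_eq_div_iff_mult_less_eq)
    moreover have "n mod a < a" using False by simp
    ultimately obtain e where e: "n div a = e + n mod a"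
      by (metis add.commute le_add_diff_inverse less_imp_le order_trans)
    have "n = (e + n mod a) * a + n mod a" unfolding e[symmetric] by simp
    also have "\<dots> = e * a + (n mod a) * (a + 1)" by (simp add: algebra_simps)
    also have "\<dots> \<in> S" using add[OF mult[OF a(1)] mult[OF a(2)]] \<open>d = 1\<close> by simp
    finally show ?thesis .
  qed
  then show ?thesis by blast
qed

lemma lengths_of_concats_cofinite:
  assumes "Gcd (length ` W) = 1"
  shows "\<exists>N. \<forall>n\<ge>N. \<exists>cs\<in>lists W. length (concat cs) = n"
proof -
  let ?S = "(\<lambda>cs. length (concat cs)) ` lists W"
  have "Gcd ?S dvd Gcd (length ` W)"
  proof (rule Gcd_greatest)
    fix n assume "n \<in> length ` W"
    then obtain w where "w \<in> W" "n = length (concat [w])" by auto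
    then show "Gcd ?S dvd n" by (intro Gcd_dvd image_eqI[of _ _ "[w]"]) auto
  qed
  then have gcd: "Gcd ?S = 1" using assms by simp
  have "\<exists>N. \<forall>n\<ge>N. n \<in> ?S"
  proof (rule submonoid_nat_cofinite[OF _ _ gcd])
    show "0 \<in> ?S" by (intro image_eqI[of _ _ "[]"]) auto
    show "a + b \<in> ?S" if "a \<in> ?S" "b \<in> ?S" for a b
    proof -
      obtain cs ds where "cs \<in> lists W" "ds \<in> lists W"
        "a = length (concat cs)" "b = length (concat ds)" using \<open>a \<in> ?S\<close> \<open>b \<in> ?S\<close> by auto
      then show ?thesis by (intro image_eqI[of _ _ "cs @ ds"]) auto
    qed
  qed
  then show ?thesis by (metis (no_types, lifting) imageE)
qed

section \<open>Words and cylinders\<close>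

lemma occurs_at_append:
  "occurs_at (u @ v) x i \<longleftrightarrow> occurs_at u x i \<and> occurs_at v x (i + int (length u))"
proof
  assume *: "occurs_at (u @ v) x i"
  have "x (i + int (length u) + int k) = v ! k" if "k < length v" for k
    using *[unfolded occurs_at_def, rule_format, of "length u + k"] that by (simp add: add.assoc)
  then show "occurs_at u x i \<and> occurs_at v x (i + int (length u))"
    using * by (auto simp: occurs_at_def nth_append)
next
  assume *: "occurs_at u x i \<and> occurs_at v x (i + int (length u))"
  have "x (i + int k) = v ! (k - length u)" if "\<not> k < length u" "k < length u + length v" for k
    using *[unfolded occurs_at_def, THEN conjunct2, rule_format, of "k - length u"] that
    by (simp add: of_nat_diff)
  then show "occurs_at (u @ v) x i"
    using * by (auto simp: occurs_at_def nth_append)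
qed

lemma occurs_at_shift_power: "occurs_at w (shift_power n x) i \<longleftrightarrow> occurs_at w x (i + n)"
  by (simp add: occurs_at_def shift_power_apply algebra_simps)

lemma occurs_at_cong:
  assumes "\<And>j. i \<le> j \<Longrightarrow> j < i + int (length w) \<Longrightarrow> x j = y j"
  shows "occurs_at w x i \<longleftrightarrow> occurs_at w y i"
  using assms by (auto simp: occurs_at_def)

definition window :: "(int \<Rightarrow> 'a) \<Rightarrow> int \<Rightarrow> nat \<Rightarrow> 'a list" where
  "window x i n = map (\<lambda>k. x (i + int k)) [0..<n]"

lemma length_window [simp]: "length (window x i n) = n"
  by (simp add: window_def)

lemma occurs_at_window: "occurs_at (window x i n) x i"
  by (simp add: window_def occurs_at_def)

lemma occurs_at_window_iff: "occurs_at (window x i n) y i \<longleftrightarrow> (\<forall>j\<in>{i..<i + int n}. y j = x j)"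
proof -
  have "j \<in> {i..<i + int n} \<longleftrightarrow> (\<exists>k<n. j = i + int k)" for j
    by (auto intro!: exI[of _ "nat (j - i)"])
  then show ?thesis by (auto simp: window_def occurs_at_def)
qed

text \<open>Carries several words at fixed mutual distances from one point to another: it suffices
  that a window containing them all recurs.\<close>

lemma occurs_at_windowD:
  assumes "occurs_at (window x i n) y j" "occurs_at w x (i + int k)" "k + length w \<le> n"
  shows "occurs_at w y (j + int k)"
  unfolding occurs_at_def
proof (intro allI impI)
  fix l assume "l < length w"
  then have "k + l < n" and w: "x (i + int k + int l) = w ! l"
    using assms(2,3) by (auto simp: occurs_at_def)
  then have "y (j + int (k + l)) = x (i + int (k + l))"
    using assms(1) by (simp add: occurs_at_def window_def del: of_nat_add)
  then show "y (j + int k + int l) = w ! l" using w by (simp add: add.assoc)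
qed

section \<open>Cylinders and closures in the full shift\<close>

lemma topspace_full_shift: "x \<in> topspace (full_shift A) \<longleftrightarrow> (\<forall>i. x i \<in> A)"
  by (auto simp: full_shift_def)

lemma openin_cylinder:
  assumes "finite I"
  shows "openin (full_shift A) {y \<in> topspace (full_shift A). \<forall>i\<in>I. y i = x i}"
  using assms
proof (induction I rule: finite_induct)
  case empty
  then show ?case by simp
next
  case (insert i I)
  have "continuous_map (full_shift A) (discrete_topology A) (\<lambda>y. y i)"
    unfolding full_shift_def by (rule continuous_map_product_projection) simp
  \<comment> \<open>Intersecting with \<open>A\<close> gives an open set of
    \<open>discrete_topology A\<close> even if \<open>x i\<close> is not in \<open>A\<close>;
    nothing is assumed about \<open>x\<close>.\<close>
  then have "openin (full_shift A) {y \<in> topspace (full_shift A). y i \<in> {x i} \<inter> A}"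
    by (rule openin_continuous_map_preimage) simp
  from openin_Int[OF this insert.IH]
  have "openin (full_shift A) ({y \<in> topspace (full_shift A). y i \<in> {x i} \<inter> A}
      \<inter> {y \<in> topspace (full_shift A). \<forall>i\<in>I. y i = x i})" .
  also have "{y \<in> topspace (full_shift A). y i \<in> {x i} \<inter> A}
      \<inter> {y \<in> topspace (full_shift A). \<forall>i\<in>I. y i = x i}
      = {y \<in> topspace (full_shift A). \<forall>i\<in>insert i I. y i = x i}"
    by (auto simp: topspace_full_shift)
  finally show ?case .
qed

text \<open>A basic open set of the product restricts only finitely many coordinates;
  \<open>N\<close> bounds their absolute values.\<close>

lemma open_contains_cylinder:
  assumes "openin (full_shift A) U" "x \<in> U"
  shows "\<exists>N::nat. \<forall>y\<in>topspace (full_shift A). (\<forall>i\<in>{- int N..int N}. y i = x i) \<longrightarrow> y \<in> U"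
proof -
  obtain V where V: "x \<in> PiE UNIV V" "finite {i. V i \<noteq> A}" "PiE UNIV V \<subseteq> U"
    using product_topology_open_contains_basis[OF assms[unfolded full_shift_def]] by auto
  define N where "N = Max (insert 0 ((\<lambda>i. nat \<bar>i\<bar>) ` {i. V i \<noteq> A}))"
  have N: "i \<in> {- int N..int N}" if "V i \<noteq> A" for i
  proof -
    have "nat \<bar>i\<bar> \<le> N" unfolding N_def using V(2) that by (intro Max_ge) auto
    then show ?thesis by auto
  qed
  have "y \<in> U" if y: "y \<in> topspace (full_shift A)" "\<forall>i\<in>{- int N..int N}. y i = x i" for y
  proof -
    have "y i \<in> V i" for i
      using y V(1) N[of i] by (cases "V i = A") (auto simp: topspace_full_shift PiE_iff)
    then show ?thesis using V(3) by auto
  qed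
  then show ?thesis by blast
qed

lemma in_closure_full_shift:
  assumes "S \<subseteq> topspace (full_shift A)"
  shows "x \<in> full_shift A closure_of S \<longleftrightarrow>
    (\<forall>N::nat. \<exists>y\<in>S. \<forall>i\<in>{- int N..int N}. y i = x i)"
proof
  assume x: "x \<in> full_shift A closure_of S"
  show "\<forall>N::nat. \<exists>y\<in>S. \<forall>i\<in>{- int N..int N}. y i = x i"
  proof
    fix N :: nat
    define U where "U = {y \<in> topspace (full_shift A). \<forall>i\<in>{- int N..int N}. y i = x i}"
    have "openin (full_shift A) U" unfolding U_def by (rule openin_cylinder) simp
    moreover have "x \<in> U" using x by (simp add: U_def in_closure_of)
    ultimately obtain y where "y \<in> S" "y \<in> U" using x unfolding in_closure_of by blast
    then show "\<exists>y\<in>S. \<forall>i\<in>{- int N..int N}. y i = x i" by (auto simp: U_def)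
  qed
next
  assume *: "\<forall>N::nat. \<exists>y\<in>S. \<forall>i\<in>{- int N..int N}. y i = x i"
  \<comment> \<open>The closure lies in the topological space, so \<open>x\<close> must first be
    seen to take values in \<open>A\<close>: some \<open>y\<close> in \<open>S\<close> agrees with
    it at \<open>i\<close>.\<close>
  have "x i \<in> A" for i
  proof -
    obtain y where "y \<in> S" "\<forall>j\<in>{- int (nat \<bar>i\<bar>)..int (nat \<bar>i\<bar>)}. y j = x j"
      using spec[OF *, of "nat \<bar>i\<bar>"] by (elim bexE)
    moreover have "i \<in> {- int (nat \<bar>i\<bar>)..int (nat \<bar>i\<bar>)}" by auto
    ultimately have "y i = x i" by blast
    moreover have "y i \<in> A" using assms \<open>y \<in> S\<close> by (auto simp: topspace_full_shift subset_iff)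
    ultimately show ?thesis by simp
  qed
  then have "x \<in> topspace (full_shift A)" by (simp add: topspace_full_shift)
  moreover have "\<exists>y. y \<in> S \<and> y \<in> T" if T: "x \<in> T" "openin (full_shift A) T" for T
  proof -
    obtain N :: nat where
      N: "\<forall>y\<in>topspace (full_shift A). (\<forall>i\<in>{- int N..int N}. y i = x i) \<longrightarrow> y \<in> T"
      using open_contains_cylinder[OF T(2,1)] by (elim exE)
    obtain y where "y \<in> S" "\<forall>i\<in>{- int N..int N}. y i = x i" using spec[OF *, of N] by (elim bexE)
    then show ?thesis using N assms by auto
  qed
  ultimately show "x \<in> full_shift A closure_of S" by (auto simp: in_closure_of)
qed

section \<open>Subshifts\<close>

lemma subshift_alphabet:
  assumes "subshift A X" "x \<in> X"
  shows "x i \<in> A"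
proof -
  have "X \<subseteq> topspace (full_shift A)"
    using assms(1) by (auto simp: subshift_def dest: closedin_subset)
  then show ?thesis using assms(2) topspace_full_shift[of x A] by blast
qed

text \<open>Negative powers stay in \<open>X\<close> because the shift is injective and maps
  \<open>X\<close> onto itself.\<close>

lemma subshift_shift_power:
  fixes X :: "(int \<Rightarrow> 'a) set"
  assumes "subshift A X" "x \<in> X"
  shows "shift_power n x \<in> X"
proof -
  have img: "shift_map ` X = X" using assms(1) by (simp add: subshift_def)
  have inj: "inj (shift_map :: (int \<Rightarrow> 'a) \<Rightarrow> _)"
  proof (rule injI, rule ext)
    fix x y :: "int \<Rightarrow> 'a" and i
    assume "shift_map x = shift_map y"
    from fun_cong[OF this, of "i - 1"] show "x i = y i" by (simp add: shift_map_def)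
  qed
  have "inv shift_map y \<in> X" if "y \<in> X" for y
    using that img inv_f_f[OF inj] by (metis imageE)
  then have "(inv shift_map ^^ k) x \<in> X" for k
    by (induction k) (use assms(2) in auto)
  moreover have "(shift_map ^^ k) x \<in> X" for k
    by (induction k) (use assms(2) img in auto)
  ultimately show ?thesis by (simp add: shift_power_def)
qed

lemma languageI: "x \<in> X \<Longrightarrow> occurs_at w x i \<Longrightarrow> w \<in> language X"
  by (auto simp: language_def)

text \<open>Every central window of \<open>x\<close> occurs in a point of \<open>X\<close>, which
  can be shifted to agree with \<open>x\<close> there; closedness of \<open>X\<close> does the
  rest.\<close>

lemma subshift_memI:
  assumes "subshift A X" and "\<And>i n. window x i n \<in> language X"
  shows "x \<in> X"
proof -
  have closed: "closedin (full_shift A) X" using assms(1) by (simp add: subshift_def)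
  have "\<exists>y\<in>X. \<forall>i\<in>{- int N..int N}. y i = x i" for N :: nat
  proof -
    obtain y j where y: "y \<in> X" "occurs_at (window x (- int N) (2 * N + 1)) y j"
      using assms(2)[of "- int N" "2 * N + 1"] by (auto simp: language_def)
    have "occurs_at (window x (- int N) (2 * N + 1)) (shift_power (j + int N) y) (- int N)"
      using y(2) by (simp add: occurs_at_shift_power)
    then have "\<forall>i\<in>{- int N..int N}. shift_power (j + int N) y i = x i"
      by (simp add: occurs_at_window_iff)
    then show ?thesis using subshift_shift_power[OF assms(1) y(1)] by blast
  qed
  then have "x \<in> full_shift A closure_of X"
    using in_closure_full_shift[OF closedin_subset[OF closed]] by blast
  then show ?thesis using closure_of_closedin[OF closed] by simp
qed

section \<open>Mixing expressed by words\<close>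

lemma hitting_times_iff: "n \<in> hitting_times U V \<longleftrightarrow> (\<exists>x\<in>U. shift_power n x \<in> V)"
proof -
  have "x = shift_power (- n) y \<longleftrightarrow> y = shift_power n x" for x y :: "int \<Rightarrow> 'a"
    by (auto simp: shift_power_apply)
  then show ?thesis by (auto simp: hitting_times_def disjoint_iff image_iff)
qed

text \<open>Cylinders of words, up to shifts, form a base. Only distances \<open>n >= 0\<close> are
  needed, since negative hitting times of a pair are positive ones of the exchanged pair.\<close>

lemma mixing_shift_words:
  assumes sub: "subshift A X"
  shows "mixing_shift A X \<longleftrightarrow> (\<forall>u\<in>language X. \<forall>v\<in>language X. \<exists>N. \<forall>n\<ge>N.
    \<exists>x\<in>X. \<exists>i. occurs_at u x i \<and> occurs_at v x (i + int n))"
proof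
  assume mix: "mixing_shift A X"
  show "\<forall>u\<in>language X. \<forall>v\<in>language X. \<exists>N. \<forall>n\<ge>N.
    \<exists>x\<in>X. \<exists>i. occurs_at u x i \<and> occurs_at v x (i + int n)"
  proof (intro ballI)
    fix u v assume uv: "u \<in> language X" "v \<in> language X"
    let ?C = "\<lambda>w. {x \<in> X. occurs_at w x 0}"
    have cyl: "openin (subtopology (full_shift A) X) (?C w) \<and> ?C w \<noteq> {}"
      if "w \<in> language X" for w
    proof
      from that obtain x i where x: "x \<in> X" "occurs_at w x i" by (auto simp: language_def)
      define y where "y = shift_power i x"
      have y: "y \<in> X" "occurs_at w y 0"
        using x subshift_shift_power[OF sub] by (auto simp: y_def occurs_at_shift_power)
      then show "?C w \<noteq> {}" by blast
      have "occurs_at w z 0 \<longleftrightarrow> (\<forall>j\<in>int ` {..<length w}. z j = y j)" for z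
        using y(2) by (auto simp: occurs_at_def)
      then have "?C w = {z \<in> topspace (full_shift A). \<forall>j\<in>int ` {..<length w}. z j = y j} \<inter> X"
        using subshift_alphabet[OF sub] by (auto simp: topspace_full_shift)
      then show "openin (subtopology (full_shift A) X) (?C w)"
        unfolding openin_subtopology using openin_cylinder[of "int ` {..<length w}" A y] by blast
    qed
    have fin: "finite (- hitting_times (?C u) (?C v))"
      using mix cyl[OF uv(1)] cyl[OF uv(2)] unfolding mixing_shift_def by blast
    then obtain M where M: "\<And>k. k \<in> - hitting_times (?C u) (?C v) \<Longrightarrow> k \<le> M"
      by (meson Max_ge)
    have "\<exists>x\<in>X. \<exists>i. occurs_at u x i \<and> occurs_at v x (i + int n)" if "n \<ge> nat (M + 1)" for n
    proof -
      have "int n \<in> hitting_times (?C u) (?C v)" using M[of "int n"] that by force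
      then obtain x where "x \<in> X" "occurs_at u x 0" "occurs_at v x (0 + int n)"
        by (auto simp: hitting_times_iff occurs_at_shift_power)
      then show ?thesis by blast
    qed
    then show "\<exists>N. \<forall>n\<ge>N. \<exists>x\<in>X. \<exists>i. occurs_at u x i \<and> occurs_at v x (i + int n)" by blast
  qed
next
  assume *: "\<forall>u\<in>language X. \<forall>v\<in>language X. \<exists>N. \<forall>n\<ge>N.
    \<exists>x\<in>X. \<exists>i. occurs_at u x i \<and> occurs_at v x (i + int n)"
  have half: "\<exists>M. \<forall>n\<ge>M. \<exists>x\<in>U. shift_power (int n) x \<in> V"
    if U: "openin (subtopology (full_shift A) X) U" "U \<noteq> {}"
      and V: "openin (subtopology (full_shift A) X) V" "V \<noteq> {}" for U V
  proof -
    have cyl: "\<exists>(N::nat) w. w \<in> language X \<and> (\<forall>y\<in>X. occurs_at w y (- int N) \<longrightarrow> y \<in> T)"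
      if T: "openin (subtopology (full_shift A) X) T" "T \<noteq> {}" for T
    proof -
      obtain O' where O': "openin (full_shift A) O'" "T = O' \<inter> X"
        using T(1) by (auto simp: openin_subtopology)
      obtain x where x: "x \<in> T" using T(2) by blast
      then obtain N :: nat where
        N: "\<forall>y\<in>topspace (full_shift A). (\<forall>i\<in>{- int N..int N}. y i = x i) \<longrightarrow> y \<in> O'"
        using open_contains_cylinder[OF O'(1), of x] O'(2) by blast
      let ?w = "window x (- int N) (2 * N + 1)"
      have "y \<in> T" if "y \<in> X" "occurs_at ?w y (- int N)" for y
      proof -
        have "\<forall>i\<in>{- int N..int N}. y i = x i"
          using that(2) by (simp add: occurs_at_window_iff)
        moreover have "y \<in> topspace (full_shift A)"
          using subshift_alphabet[OF sub that(1)] by (simp add: topspace_full_shift)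
        ultimately show ?thesis using N O'(2) that(1) by blast
      qed
      moreover have "?w \<in> language X"
        using x O'(2) occurs_at_window by (intro languageI) auto
      ultimately show ?thesis by blast
    qed
    obtain K u where u: "u \<in> language X" "\<And>y. y \<in> X \<Longrightarrow> occurs_at u y (- int K) \<Longrightarrow> y \<in> U"
      using cyl[OF U] by blast
    obtain L v where v: "v \<in> language X" "\<And>y. y \<in> X \<Longrightarrow> occurs_at v y (- int L) \<Longrightarrow> y \<in> V"
      using cyl[OF V] by blast
    obtain N where N: "\<And>n. n \<ge> N \<Longrightarrow> \<exists>x\<in>X. \<exists>i. occurs_at u x i \<and> occurs_at v x (i + int n)"
      using * u(1) v(1) by blast
    \<comment> \<open>The cylinders fix \<open>u\<close> at \<open>- K\<close> and \<open>v\<close>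
      at \<open>- L\<close>, so hitting time \<open>n\<close> means distance
      \<open>n + K - L\<close> between the words. The bound makes this natural subtraction
      exact.\<close>
    have "\<exists>x\<in>U. shift_power (int n) x \<in> V" if n: "n \<ge> N + L" for n
    proof -
      have "N \<le> n + K - L" using n by simp
      from N[OF this] obtain x i
        where x: "x \<in> X" "occurs_at u x i" "occurs_at v x (i + int (n + K - L))" by blast
      let ?y = "shift_power (i + int K) x"
      have "?y \<in> U"
        using x subshift_shift_power[OF sub] by (intro u(2)) (auto simp: occurs_at_shift_power)
      moreover have "shift_power (int n) ?y \<in> V"
      proof (rule v(2))
        show "shift_power (int n) ?y \<in> X"
          using x subshift_shift_power[OF sub] by blast
        have "i + int (n + K - L) = - int L + int n + (i + int K)" using n by simp
        then show "occurs_at v (shift_power (int n) ?y) (- int L)"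
          using x(3) by (simp only: occurs_at_shift_power)
      qed
      ultimately show ?thesis by blast
    qed
    then show ?thesis by blast
  qed
  show "mixing_shift A X"
    unfolding mixing_shift_def
  proof (intro allI impI, elim conjE)
    fix U V
    assume U: "openin (subtopology (full_shift A) X) U" "U \<noteq> {}"
      and V: "openin (subtopology (full_shift A) X) V" "V \<noteq> {}"
    obtain M where M: "\<And>n. n \<ge> M \<Longrightarrow> \<exists>x\<in>U. shift_power (int n) x \<in> V"
      using half[OF U V] by blast
    obtain M' where M': "\<And>n. n \<ge> M' \<Longrightarrow> \<exists>x\<in>V. shift_power (int n) x \<in> U"
      using half[OF V U] by blast
    \<comment> \<open>Times above \<open>M\<close> come from \<open>U\<close>, \<open>V\<close>;
      times below \<open>- M'\<close> come from \<open>V\<close>, \<open>U\<close> by applying the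
      inverse shift.\<close>
    have "- hitting_times U V \<subseteq> {- int M'..int M}"
    proof
      fix k assume k: "k \<in> - hitting_times U V"
      have "k \<le> int M"
      proof (rule ccontr)
        assume "\<not> k \<le> int M"
        then show False using M[of "nat k"] k by (auto simp: hitting_times_iff)
      qed
      moreover have "- int M' \<le> k"
      proof (rule ccontr)
        assume "\<not> - int M' \<le> k"
        then have "M' \<le> nat (- k)" "int (nat (- k)) = - k" by auto
        then obtain x where "x \<in> V" "shift_power (- k) x \<in> U" using M' by metis
        moreover have "shift_power k (shift_power (- k) x) = x" by (simp add: shift_power_apply)
        ultimately show False using k by (auto simp: hitting_times_iff)
      qed
      ultimately show "k \<in> {- int M'..int M}" by simp
    qed
    then show "finite (- hitting_times U V)" using finite_subset by blast
  qed
qed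

section \<open>Bi-infinite concatenations\<close>

lemma occurs_at_concat:
  fixes p :: "int \<Rightarrow> int"
  assumes "\<And>j. p (j + 1) = p j + int (length (ws j)) \<and> occurs_at (ws j) x (p j)"
  shows "occurs_at (concat (map (\<lambda>k. ws (j + int k)) [0..<n])) x (p j) \<and>
    p (j + int n) = p j + int (length (concat (map (\<lambda>k. ws (j + int k)) [0..<n])))"
proof (induction n)
  case 0
  then show ?case by (simp add: occurs_at_def)
next
  case (Suc n)
  then show ?case using assms[of "j + int n"] by (simp add: occurs_at_append algebra_simps)
qed

lemma positions_unbounded:
  fixes p :: "int \<Rightarrow> int"
  assumes "\<And>j. p j < p (j + 1)"
  shows "p j + int n \<le> p (j + int n)" and "p (j - int n) \<le> p j - int n"
proof -
  show *: "p j + int n \<le> p (j + int n)" for j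
  proof (induction n)
    case (Suc n)
    then show ?case using assms[of "j + int n"] by (simp add: algebra_simps)
  qed simp
  show "p (j - int n) \<le> p j - int n" using *[of "j - int n"] by simp
qed

text \<open>Positions grow by at least 1 per word, so finitely many consecutive words reach from
  left of \<open>i\<close> to right of the window.\<close>

lemma biinfinite_concat_covers:
  assumes "x \<in> biinfinite_concats W" "[] \<notin> W"
  shows "\<exists>cs\<in>lists W. \<exists>a b. concat cs = a @ window x i n @ b"
proof -
  obtain ws p where ws: "\<And>j. ws j \<in> W"
    and p: "\<And>j::int. p (j + 1) = p j + int (length (ws j)) \<and> occurs_at (ws j) x (p j)"
    using assms(1) by (auto simp: biinfinite_concats_def)
  have "length (ws j) > 0" for j using ws[of j] assms(2) by auto
  then have less: "p j < p (j + 1)" for j using p[of j] by (metis less_add_same_cancel1 of_nat_0_less_iff)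
  \<comment> \<open>Going back \<open>p 0 - i\<close> words from word 0 passes \<open>i\<close>;
    \<open>nat\<close> yields 0 steps if word 0 already starts at or before
    \<open>i\<close>.\<close>
  define j where "j = - int (nat (p 0 - i))"
  have "p j \<le> p 0 - int (nat (p 0 - i))"
    using positions_unbounded(2)[of p, OF less, where j=0 and n="nat (p 0 - i)"]
    by (simp only: j_def diff_0)
  then have j: "p j \<le> i" by linarith
  define k where "k = nat (i + int n - p j)"
  have k: "i + int n \<le> p (j + int k)"
    using positions_unbounded(1)[of p, OF less, where j=j and n=k] j by (simp add: k_def)
  define cs where "cs = map (\<lambda>l. ws (j + int l)) [0..<k]"
  have cs: "cs \<in> lists W" using ws by (auto simp: cs_def)
  define s where "s = concat cs"
  have s: "occurs_at s x (p j)" "p (j + int k) = p j + int (length s)"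
    using occurs_at_concat[of p ws x j k, OF p] unfolding s_def cs_def by auto
  define q where "q = nat (i - p j)"
  have q: "int q = i - p j" "q + n \<le> length s" using j k s(2) by (auto simp: q_def)
  have "window x i n = take n (drop q s)"
  proof (rule nth_equalityI)
    show "length (window x i n) = length (take n (drop q s))" using q(2) by simp
    fix l assume "l < length (window x i n)"
    then have l: "l < n" by simp
    then have "x (p j + int (q + l)) = s ! (q + l)"
      using s(1) q(2) by (simp add: occurs_at_def del: of_nat_add)
    then show "window x i n ! l = take n (drop q s) ! l" using l q by (simp add: window_def)
  qed
  then have "s = take q s @ window x i n @ drop n (drop q s)" by (metis append_take_drop_id)
  then show ?thesis using cs unfolding s_def by blast
qed

text \<open>The starting positions are partial sums of lengths. Since they increase, the intervals
  from \<open>p j\<close> to \<open>p (j + 1)\<close> are disjoint, so \<open>THE\<close> finds the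
  unique word covering a coordinate.\<close>

lemma ex_biinfinite_concat:
  fixes ws :: "int \<Rightarrow> 'a list"
  assumes nonempty: "\<And>j. ws j \<noteq> []"
  shows "\<exists>x p. \<forall>j. p (j + 1) = p j + int (length (ws j)) \<and> occurs_at (ws j) x (p j)"
proof -
  \<comment> \<open>Normalised by \<open>p 0 = 0\<close>; for either sign of \<open>j\<close> at
    least one of the two sums is empty.\<close>
  define p where "p j = (\<Sum>i\<in>{0..<j}. int (length (ws i))) - (\<Sum>i\<in>{j..<0}. int (length (ws i)))" for j
  have p: "p (j + 1) = p j + int (length (ws j))" for j
  proof (cases "j \<ge> 0")
    case True
    then have "{0..<j + 1} = insert j {0..<j}" "{j..<0} = {}" "{j + 1..<0} = {}" by auto
    then show ?thesis by (simp add: p_def)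
  next
    case False
    then have "{j..<0} = insert j {j + 1..<0}" "{0..<j} = {}" "{0..<j + 1} = {}" by auto
    then show ?thesis by (simp add: p_def)
  qed
  have less: "p j < p (j + 1)" for j using p[of j] nonempty[of j] by simp
  have mono: "p j \<le> p k" if "j \<le> k" for j k
    using positions_unbounded(1)[of p, OF less, where j=j and n="nat (k - j)"] that by simp
  define x where "x i = (let j = THE j. p j \<le> i \<and> i < p (j + 1) in ws j ! nat (i - p j))" for i
  have "occurs_at (ws j) x (p j)" for j
    unfolding occurs_at_def
  proof (intro allI impI)
    fix k assume k: "k < length (ws j)"
    have "(THE j'. p j' \<le> p j + int k \<and> p j + int k < p (j' + 1)) = j"
    proof (rule the_equality)
      show "p j \<le> p j + int k \<and> p j + int k < p (j + 1)" using k p[of j] by simp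
      fix j' assume j': "p j' \<le> p j + int k \<and> p j + int k < p (j' + 1)"
      show "j' = j"
        using mono[of "j' + 1" j] mono[of "j + 1" j'] j' k p[of j] by force
    qed
    then show "x (p j + int k) = ws j ! k" by (simp add: x_def)
  qed
  with p show ?thesis by blast
qed

lemma concat_occurs_in_biinfinite_concat:
  assumes "cs \<in> lists W" "cs \<noteq> []" "[] \<notin> W"
  shows "\<exists>x\<in>biinfinite_concats W. \<exists>i. occurs_at (concat cs) x i"
proof -
  \<comment> \<open>The finite list is padded on both sides by copies of its first word, which
    exists as \<open>cs\<close> is nonempty.\<close>
  define ws where "ws j = (if 0 \<le> j \<and> j < int (length cs) then cs ! nat j else hd cs)" for j :: int
  have ws: "ws j \<in> W" for j
    using assms(1,2) by (auto simp: ws_def in_lists_conv_set)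
  then have "ws j \<noteq> []" for j using assms(3) by metis
  then obtain x p where x: "\<And>j. p (j + 1) = p j + int (length (ws j)) \<and> occurs_at (ws j) x (p j)"
    using ex_biinfinite_concat[of ws] by blast
  have "map (\<lambda>k. ws (0 + int k)) [0..<length cs] = cs"
    by (rule nth_equalityI) (auto simp: ws_def)
  then have "occurs_at (concat cs) x (p 0)"
    using occurs_at_concat[of p ws x 0 "length cs", OF x] by simp
  moreover have "x \<in> biinfinite_concats W" using ws x by (auto simp: biinfinite_concats_def)
  ultimately show ?thesis by blast
qed

section \<open>Generators and the language\<close>

lemma biinfinite_concats_alphabet:
  assumes "x \<in> biinfinite_concats W" "W \<subseteq> lists A - {[]}"
  shows "x i \<in> A"
proof -
  obtain cs a b where cs: "cs \<in> lists W" "concat cs = a @ window x i 1 @ b"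
    using biinfinite_concat_covers[OF assms(1)] assms(2) by blast
  then have "x i \<in> set (concat cs)" by (simp add: window_def)
  then show ?thesis using cs(1) assms(2) by (auto simp: in_lists_conv_set)
qed

lemma biinfinite_concats_subset_topspace:
  assumes "W \<subseteq> lists A - {[]}"
  shows "biinfinite_concats W \<subseteq> topspace (full_shift A)"
  using biinfinite_concats_alphabet[OF _ assms] by (auto simp: topspace_full_shift)

text \<open>A point of the closure agrees with a concatenation on any finite block, which gives the
  first claim; the second follows by extending to a bi-infinite concatenation. The condition
  \<open>cs \<noteq> []\<close> matters if \<open>W\<close> is empty, when \<open>X\<close> and its
  language are empty too.\<close>

lemma generator_language:
  assumes "generator A X W"
  shows "u \<in> language X \<Longrightarrow> \<exists>cs\<in>lists W. \<exists>a b. concat cs = a @ u @ b"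
    and "cs \<in> lists W \<Longrightarrow> cs \<noteq> [] \<Longrightarrow> concat cs \<in> language X"
proof -
  have W: "W \<subseteq> lists A - {[]}" and X: "X = full_shift A closure_of biinfinite_concats W"
    using assms by (auto simp: generator_def)
  note top = biinfinite_concats_subset_topspace[OF W]
  show "\<exists>cs\<in>lists W. \<exists>a b. concat cs = a @ u @ b" if "u \<in> language X"
  proof -
    from that obtain x i where x: "x \<in> X" "occurs_at u x i" by (auto simp: language_def)
    define N where "N = nat \<bar>i\<bar> + length u"
    obtain y where y: "y \<in> biinfinite_concats W" "\<forall>j\<in>{- int N..int N}. y j = x j"
      using x(1) in_closure_full_shift[OF top, of x] X by blast
    have "y j = x j" if "i \<le> j" "j < i + int (length u)" for j
      using y(2) that by (simp add: N_def) (smt (verit) Ball_def atLeastAtMost_iff)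
    then have "occurs_at u y i" using occurs_at_cong[of i u y x] x(2) by blast
    then have "window y i (length u) = u"
      by (intro nth_equalityI) (auto simp: window_def occurs_at_def)
    then show ?thesis using biinfinite_concat_covers[OF y(1), of i "length u"] W by auto
  qed
  show "concat cs \<in> language X" if cs: "cs \<in> lists W" "cs \<noteq> []"
  proof -
    obtain x i where x: "x \<in> biinfinite_concats W" "occurs_at (concat cs) x i"
      using concat_occurs_in_biinfinite_concat[OF cs] W by blast
    then have "x \<in> X" using closure_of_subset[OF top] X by blast
    then show ?thesis using x(2) by (rule languageI)
  qed
qed

text \<open>\<open>concats\<close> and closedness of \<open>X\<close> give that the closure lies in
  \<open>X\<close>; \<open>covers\<close> gives density. Asking for \<open>u\<close> inside a single
  element of \<open>W\<close> suits the set built from the half-synchronizing word.\<close>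

lemma generatorI:
  assumes sub: "subshift A X" and W: "countable W" "W \<subseteq> lists A - {[]}"
    and concats: "\<And>cs. cs \<in> lists W \<Longrightarrow> concat cs \<in> language X"
    and covers: "\<And>u. u \<in> language X \<Longrightarrow> u \<noteq> [] \<Longrightarrow> \<exists>a b. a @ u @ b \<in> W"
  shows "generator A X W"
proof -
  note top = biinfinite_concats_subset_topspace[OF W(2)]
  have closed: "closedin (full_shift A) X" using sub by (simp add: subshift_def)
  have "biinfinite_concats W \<subseteq> X"
  proof
    fix x assume x: "x \<in> biinfinite_concats W"
    show "x \<in> X"
    proof (rule subshift_memI[OF sub])
      fix i n
      obtain cs a b where cs: "cs \<in> lists W" "concat cs = a @ window x i n @ b"
        using biinfinite_concat_covers[OF x] W(2) by blast
      then obtain y j where "y \<in> X" "occurs_at (a @ window x i n @ b) y j"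
        using concats[OF cs(1)] by (auto simp: language_def)
      then show "window x i n \<in> language X"
        using languageI[of y X "window x i n"] unfolding occurs_at_append by blast
    qed
  qed
  then have "full_shift A closure_of biinfinite_concats W \<subseteq> X"
    using closed by (rule closure_of_minimal)
  moreover have "X \<subseteq> full_shift A closure_of biinfinite_concats W"
  proof
    fix x assume x: "x \<in> X"
    have "\<exists>y\<in>biinfinite_concats W. \<forall>i\<in>{- int N..int N}. y i = x i" for N :: nat
    proof -
      let ?u = "window x (- int N) (2 * N + 1)"
      have "?u \<in> language X" using x occurs_at_window by (rule languageI)
      moreover have "?u \<noteq> []" by (metis add_is_0 length_window list.size(3) one_neq_zero)
      ultimately obtain a b where "a @ ?u @ b \<in> W" using covers by blast
      then obtain y i where y: "y \<in> biinfinite_concats W" "occurs_at (a @ ?u @ b) y i"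
        using concat_occurs_in_biinfinite_concat[of "[a @ ?u @ b]" W] W(2) by auto
      \<comment> \<open>Shifting by \<open>d\<close> moves the occurrence of \<open>?u\<close> to
        start at \<open>- N\<close>; the result is still a concatenation, with all positions moved
        by \<open>d\<close>.\<close>
      define d where "d = i + int (length a) + int N"
      have "shift_power d y \<in> biinfinite_concats W"
      proof -
        obtain ws p where "\<forall>j::int. ws j \<in> W \<and> p (j + 1) = p j + int (length (ws j)) \<and>
          occurs_at (ws j) y (p j)" using y(1) by (auto simp: biinfinite_concats_def)
        then have "\<forall>j::int. ws j \<in> W \<and> p (j + 1) - d = p j - d + int (length (ws j)) \<and>
          occurs_at (ws j) (shift_power d y) (p j - d)" by (simp add: occurs_at_shift_power)
        then show ?thesis
          unfolding biinfinite_concats_def by (intro CollectI exI[of _ ws] exI[of _ "\<lambda>j. p j - d"])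
      qed
      moreover have "occurs_at ?u (shift_power d y) (- int N)"
        using y(2) by (simp add: occurs_at_shift_power occurs_at_append d_def)
      then have "\<forall>i\<in>{- int N..int N}. shift_power d y i = x i"
        by (simp add: occurs_at_window_iff)
      ultimately show ?thesis by blast
    qed
    then show "x \<in> full_shift A closure_of biinfinite_concats W"
      using in_closure_full_shift[OF top, of x] by blast
  qed
  ultimately show ?thesis using W by (auto simp: generator_def)
qed

section \<open>The two implications\<close>

lemma mixing_shift_if_relatively_prime_generator:
  assumes sub: "subshift A X" and gen: "generator A X W" and gcd: "Gcd (length ` W) = 1"
  shows "mixing_shift A X"
  unfolding mixing_shift_words[OF sub]
proof (intro ballI)
  fix u v assume "u \<in> language X" "v \<in> language X"
  then obtain cs a b ds c d where cs: "cs \<in> lists W" "concat cs = a @ u @ b"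
    and ds: "ds \<in> lists W" "concat ds = c @ v @ d"
    using generator_language(1)[OF gen] by metis
  \<comment> \<open>The extra word \<open>w\<close> will be put in front because \<open>cs\<close>,
    \<open>es\<close> and \<open>ds\<close> may all be empty, while only nonempty lists are known to
    give words of the language.\<close>
  have "W \<noteq> {}" using gcd by auto
  then obtain w where w: "w \<in> W" by blast
  obtain N where N: "\<And>n. n \<ge> N \<Longrightarrow> \<exists>es\<in>lists W. length (concat es) = n"
    using lengths_of_concats_cofinite[OF gcd] by blast
  have "\<exists>x\<in>X. \<exists>i. occurs_at u x i \<and> occurs_at v x (i + int n)"
    if n_ge: "n \<ge> N + length u + length b + length c" for n
  proof -
    \<comment> \<open>The filler \<open>es\<close> has exactly the length that puts the start of
      \<open>v\<close> at distance \<open>n\<close> from the start of \<open>u\<close>, with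
      \<open>b\<close> and \<open>c\<close> in between.\<close>
    have "N \<le> n - length u - length b - length c" using n_ge by simp
    from N[OF this] obtain es
      where es: "es \<in> lists W" "length (concat es) = n - length u - length b - length c" by blast
    have "concat (w # cs @ es @ ds) \<in> language X"
      using cs ds es w by (intro generator_language(2)[OF gen]) auto
    then obtain x i where x: "x \<in> X" "occurs_at (w @ a @ u @ b @ concat es @ c @ v @ d) x i"
      using cs(2) ds(2) by (auto simp: language_def)
    have n: "int n = int (length u) + int (length b) + int (length (concat es)) + int (length c)"
      using es(2) n_ge by simp
    have "occurs_at u x (i + int (length w) + int (length a))"
      "occurs_at v x (i + int (length w) + int (length a) + int n)"
      using x(2) unfolding n occurs_at_append by (simp_all add: add.assoc)
    then show ?thesis using x(1) by blast
  qed
  then show "\<exists>N. \<forall>n\<ge>N. \<exists>x\<in>X. \<exists>i. occurs_at u x i \<and> occurs_at v x (i + int n)" by blast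
qed

lemma relatively_prime_generator_if_mixing:
  assumes "finite A" and hs: "half_synchronized A X" and mix: "mixing_shift A X"
  shows "\<exists>W. generator A X W \<and> Gcd (length ` W) = 1"
proof -
  obtain m r where sub: "subshift A X" and m: "m \<in> language X" and "r \<in> left_ray ` X"
    and trans: "left_transitive X r" and mr: "occurs_at m r (- int (length m) + 1)"
    and sync: "ray_followers X r = word_followers X m"
    using hs by (auto simp: half_synchronized_def)
  then obtain x0 where x0: "x0 \<in> X" "r = left_ray x0" by blast
  have r: "r i = x0 i" if "i \<le> 0" for i using that by (simp add: x0(2) left_ray_def)
  \<comment> \<open>The starting coordinate makes \<open>m @ c\<close> end at coordinate 0, the last
    one of \<open>r\<close>.\<close>
  define W where "W = {c. c \<noteq> [] \<and> occurs_at (m @ c) r (1 - int (length m) - int (length c))}"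
  have W: "W \<subseteq> lists A - {[]}"
  proof
    fix c assume c: "c \<in> W"
    have "c ! k \<in> A" if "k < length c" for k
    proof -
      have "occurs_at c r (1 - int (length c))"
        using c unfolding W_def occurs_at_append by simp
      then have "r (1 - int (length c) + int k) = c ! k"
        using that by (simp add: occurs_at_def)
      moreover have "1 - int (length c) + int k \<le> 0" using that by simp
      ultimately show ?thesis using r subshift_alphabet[OF sub x0(1)] by metis
    qed
    then show "c \<in> lists A - {[]}" using c by (auto simp: W_def in_set_conv_nth)
  qed
  have "countable W"
    using W countable_lists[OF countable_finite[OF \<open>finite A\<close>]] countable_subset by blast
  \<comment> \<open>Keeping the whole ray \<open>r\<close> in front, rather than claiming only
    membership in the language, is what lets the induction prepend another word.\<close>
  have follow: "\<exists>z\<in>X. (\<forall>i\<le>0. z i = r i) \<and> occurs_at (concat cs) z 1" if "cs \<in> lists W" for cs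
    using that
  proof (induction cs)
    case Nil
    then show ?case using x0(1) r by (auto simp: occurs_at_def)
  next
    case (Cons c cs)
    then obtain z where z: "z \<in> X" "\<And>i. i \<le> 0 \<Longrightarrow> z i = r i" "occurs_at (concat cs) z 1"
      by blast
    have c: "occurs_at (m @ c) r (1 - int (length m) - int (length c))"
      using Cons by (auto simp: W_def)
    \<comment> \<open>The suffix \<open>c\<close> of \<open>r\<close> moves to coordinate 1, so the
      right ray of \<open>?y\<close> starts with \<open>c @ concat cs\<close> and follows
      \<open>m\<close>; by \<open>sync\<close> it then follows \<open>r\<close>.\<close>
    let ?y = "shift_power (- int (length c)) z"
    have "occurs_at (m @ c) z (1 - int (length m) - int (length c))"
      using c z(2) occurs_at_cong[of _ "m @ c" z r] by simp
    then have y: "occurs_at m ?y (0 - int (length m) + 1)" "occurs_at (c @ concat cs) ?y 1"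
      using z(3) by (auto simp: occurs_at_append occurs_at_shift_power algebra_simps)
    have "?y \<in> X" using z(1) by (rule subshift_shift_power[OF sub])
    have "\<forall>i>0. ?y (0 + i) = right_ray ?y i" by (simp add: right_ray_def)
    then have "right_ray ?y \<in> word_followers X m"
      unfolding word_followers_def using y(1) \<open>?y \<in> X\<close> by blast
    then have "right_ray ?y \<in> ray_followers X r" using sync by simp
    then obtain t n where t: "t \<in> X" "\<forall>i\<le>0. t (n + i) = r i" "\<forall>i>0. t (n + i) = right_ray ?y i"
      by (auto simp: ray_followers_def)
    have "shift_power n t i = ?y i" if "i \<ge> 1" for i
      using t(3) that by (simp add: shift_power_apply[of n] right_ray_def add.commute)
    then have "occurs_at (c @ concat cs) (shift_power n t) 1"
      using y(2) occurs_at_cong[of 1 "c @ concat cs" "shift_power n t" ?y] by simp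
    moreover have "\<forall>i\<le>0. shift_power n t i = r i"
      using t(2) by (simp add: shift_power_apply add.commute)
    ultimately show ?case using subshift_shift_power[OF sub t(1)] by auto
  qed
  \<comment> \<open>Mixing places \<open>m\<close> and \<open>v\<close> at distance \<open>n\<close>
    in some point, and left transitivity finds the block spanning both in \<open>r\<close>. Taking
    \<open>n >= length m\<close> ensures that this block contains \<open>m\<close>.\<close>
  have m_to: "\<exists>N. \<forall>n\<ge>N. \<exists>i. occurs_at m r i \<and> occurs_at v r (i + int n) \<and>
      i + int n + int (length v) \<le> 1" if v: "v \<in> language X" for v
  proof -
    obtain N where N: "\<And>n. n \<ge> N \<Longrightarrow> \<exists>x\<in>X. \<exists>i. occurs_at m x i \<and> occurs_at v x (i + int n)"
      using mix m v unfolding mixing_shift_words[OF sub] by blast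
    have "\<exists>i. occurs_at m r i \<and> occurs_at v r (i + int n) \<and> i + int n + int (length v) \<le> 1"
      if n: "n \<ge> N + length m" for n
    proof -
      obtain x i where x: "x \<in> X" "occurs_at m x i" "occurs_at v x (i + int n)"
        using N[of n] n by auto
      let ?u = "window x i (n + length v)"
      have "?u \<in> language X" using x(1) occurs_at_window by (rule languageI)
      then obtain j where j: "j + int (n + length v) \<le> 1" "occurs_at ?u r j"
        using trans unfolding left_transitive_def by (metis length_window)
      have "occurs_at m r (j + int 0)" "occurs_at v r (j + int n)"
        using occurs_at_windowD[OF j(2), of m 0] occurs_at_windowD[OF j(2), of v n] x n by simp_all
      then show ?thesis using j(1) by auto
    qed
    then show ?thesis by blast
  qed
  have "generator A X W"
  proof (rule generatorI[OF sub \<open>countable W\<close> W])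
    show "concat cs \<in> language X" if "cs \<in> lists W" for cs
      using follow[OF that] by (auto intro: languageI)
    fix u assume u: "u \<in> language X" "u \<noteq> []"
    obtain N where N: "\<And>n. n \<ge> N \<Longrightarrow> \<exists>i. occurs_at m r i \<and> occurs_at u r (i + int n) \<and>
      i + int n + int (length u) \<le> 1" using m_to[OF u(1)] by blast
    \<comment> \<open>With this distance exactly \<open>N\<close> letters, the word
      \<open>?a\<close>, separate \<open>m\<close> from \<open>u\<close>; \<open>?b\<close> is the
      rest of \<open>r\<close> up to coordinate 0.\<close>
    define n where "n = N + length m"
    obtain i where i: "occurs_at m r i" "occurs_at u r (i + int n)" "i + int n + int (length u) \<le> 1"
      using N[of n] by (auto simp: n_def)
    let ?k = "nat (1 - i - int n - int (length u))"
    let ?a = "window r (i + int (length m)) N"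
    let ?b = "window r (i + int n + int (length u)) ?k"
    have "length u > 0" using u(2) by simp
    have "occurs_at (m @ ?a @ u @ ?b) r i"
      using i(1,2) occurs_at_window[of r "i + int (length m)" N]
        occurs_at_window[of r "i + int n + int (length u)" ?k]
      by (simp add: occurs_at_append n_def algebra_simps)
    moreover have "i = 1 - int (length m) - int (length (?a @ u @ ?b))"
      using i(3) by (simp add: n_def)
    ultimately have "?a @ u @ ?b \<in> W" using u(2) unfolding W_def by simp
    then show "\<exists>a b. a @ u @ b \<in> W" by blast
  qed
  moreover have "Gcd (length ` W) = 1"
  proof -
    let ?g = "Gcd (length ` W)"
    obtain N where N: "\<And>n. n \<ge> N \<Longrightarrow> \<exists>i. occurs_at m r i \<and> occurs_at m r (i + int n) \<and>
      i + int n + int (length m) \<le> 1" using m_to[OF m] by blast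
    \<comment> \<open>What follows an occurrence of \<open>m\<close> in \<open>r\<close> up to
      coordinate 0 is either empty or an element of \<open>W\<close>.\<close>
    have len: "?g dvd nat (1 - i - int (length m))"
      if "occurs_at m r i" "i + int (length m) \<le> 1" for i
    proof (cases "nat (1 - i - int (length m)) = 0")
      case False
      define c where "c = window r (i + int (length m)) (nat (1 - i - int (length m)))"
      have len: "length c = nat (1 - i - int (length m))" by (simp add: c_def)
      have "occurs_at (m @ c) r i"
        unfolding occurs_at_append c_def using that(1) occurs_at_window by blast
      moreover have "i = 1 - int (length m) - int (length c)" using that(2) len by simp
      moreover have "c \<noteq> []" using False len by auto
      ultimately have "c \<in> W" by (simp add: W_def)
      then show ?thesis unfolding len[symmetric] by (intro Gcd_dvd imageI)
    qed simp
    \<comment> \<open>Two occurrences of \<open>m\<close> at distance \<open>n\<close> leave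
      remainders of \<open>r\<close> whose lengths differ by \<open>n\<close>, and \<open>?g\<close>
      divides both lengths.\<close>
    have dvd: "?g dvd n" if n: "n \<ge> N" for n
    proof -
      obtain i where i: "occurs_at m r i" "occurs_at m r (i + int n)"
        "i + int n + int (length m) \<le> 1" using N[OF n] by blast
      have "nat (1 - i - int (length m)) = n + nat (1 - (i + int n) - int (length m))"
        using i(3) by simp
      moreover have "?g dvd nat (1 - i - int (length m))"
        using i by (intro len) auto
      moreover have "?g dvd nat (1 - (i + int n) - int (length m))"
        using i by (intro len) auto
      ultimately show ?thesis by (metis dvd_add_left_iff)
    qed
    have "?g dvd N + 1" "?g dvd N" using dvd by simp_all
    then have "?g dvd 1" by (metis dvd_add_right_iff)
    then show ?thesis by simp
  qed
  ultimately show ?thesis by blast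
qed

theorem theorem3p4:
  fixes A :: "'a set" and X :: "(int \<Rightarrow> 'a) set"
  assumes "finite A" and "half_synchronized A X"
  shows "mixing_shift A X \<longleftrightarrow> (\<exists>W. generator A X W \<and> Gcd (length ` W) = 1)"
  using assms relatively_prime_generator_if_mixing mixing_shift_if_relatively_prime_generator
  unfolding half_synchronized_def by blast

end
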